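(* The sequence $\left(|I_k(132,123)|\right)_{k\ge 1}$ is the Pascal triangle with its first column removed, read row by row: that is, for integers $r\ge 1$ and $1\le j\le r$ and $k=\binom{r}{2}+j$, one has $|I_k(132,123)|=\binom{r}{j}$. The generating function of this sequence, with its first term as constant term, is \[\sum_{k\ge 1}|I_k(132,123)|\,x^{k-1}=\sum_{n\ge 1} x^{(n-2)(n+1)/2}\left((x+1)^n-1\right).\]
   Context: A permutation of length $n$ is a word $\pi=\pi_1\cdots\pi_n$ containing each of $1,\dots,n$ exactly once. The sum of permutations $\rho=\rho_1\cdots\rho_n$ and $\tau=\tau_1\cdots\tau_m$ is the permutation $\rho\oplus\tau=\rho_1\cdots\rho_n(n+\tau_1)\cdots(n+\tau_m)$ of length $n+m$. A permutation is decomposable if it equals $\rho\oplus\tau$ for some non-empty permutations $\rho,\tau$; a non-empty permutation that is not decomposable is indecomposable. An inversion of $\pi$ is a pair $(i,j)$ with $i<j$ and $\pi_i>\pi_j$. A permutation $\pi$ contains a permutation (pattern) $\tau=\tau_1\cdots\tau_m$ if there are indices $i_1<\dots<i_m$ such that $\pi_{i_1},\dots,\pi_{i_m}$ is order-isomorphic to $\tau_1,\dots,\tau_m$; otherwise $\pi$ avoids $\tau$. $I_k(\tau_1,\dots,\tau_r)$ denotes the (finite) set of all indecomposable permutations, of any length, with exactly $k$ inversions that avoid all of $\tau_1,\dots,\tau_r$. The term $n=1$ of the series is $x^{-1}\cdot x=1$. *)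

theory Defs
  imports
    "HOL-Analysis.Analysis"
    "HOL-Combinatorics.Combinatorics"
    "HOL-Computational_Algebra.Formal_Laurent_Series"
begin

text \<open>
  A permutation of length \<open>n\<close> is the word \<open>[\<pi>\<^sub>1, \<dots>, \<pi>\<^sub>n]\<close> as a list. The entries are
  \<open>1, \<dots>, n\<close>, but positions are list indices and hence start at \<open>0\<close>.
\<close>

definition is_permutation :: "nat list \<Rightarrow> bool" where
  "is_permutation \<pi> \<longleftrightarrow> \<pi> \<in> permutations_of_set {1..length \<pi>}"

definition perm_sum :: "nat list \<Rightarrow> nat list \<Rightarrow> nat list" where
  "perm_sum \<rho> \<tau> = \<rho> @ map (\<lambda>t. length \<rho> + t) \<tau>"

definition decomposable :: "nat list \<Rightarrow> bool" where
  "decomposable \<pi> \<longleftrightarrow>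
     (\<exists>\<rho> \<tau>. is_permutation \<rho> \<and> \<rho> \<noteq> [] \<and> is_permutation \<tau> \<and> \<tau> \<noteq> [] \<and> \<pi> = perm_sum \<rho> \<tau>)"

definition indecomposable :: "nat list \<Rightarrow> bool" where
  "indecomposable \<pi> \<longleftrightarrow> is_permutation \<pi> \<and> \<pi> \<noteq> [] \<and> \<not> decomposable \<pi>"

definition inversions :: "nat list \<Rightarrow> (nat \<times> nat) set" where
  "inversions \<pi> = {(i, j). i < j \<and> j < length \<pi> \<and> \<pi> ! i > \<pi> ! j}"

definition order_isomorphic :: "nat list \<Rightarrow> nat list \<Rightarrow> bool" where
  "order_isomorphic u v \<longleftrightarrow> length u = length v \<and>
     (\<forall>a<length u. \<forall>b<length u. u ! a < u ! b \<longleftrightarrow> v ! a < v ! b)"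

definition contains_pattern :: "nat list \<Rightarrow> nat list \<Rightarrow> bool" where
  "contains_pattern \<pi> \<tau> \<longleftrightarrow>
     (\<exists>is. sorted_wrt (<) is \<and> set is \<subseteq> {..<length \<pi>} \<and>
           order_isomorphic (map (\<lambda>i. \<pi> ! i) is) \<tau>)"

definition avoids :: "nat list \<Rightarrow> nat list \<Rightarrow> bool" where
  "avoids \<pi> \<tau> \<longleftrightarrow> \<not> contains_pattern \<pi> \<tau>"

text \<open>\<open>indec_avoiders k {\<tau>\<^sub>1, \<dots>, \<tau>\<^sub>r}\<close> is the set usually written \<open>I\<^sub>k(\<tau>\<^sub>1, \<dots>, \<tau>\<^sub>r)\<close>.\<close>

definition indec_avoiders :: "nat \<Rightarrow> nat list set \<Rightarrow> nat list set" where
  "indec_avoiders k T =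
     {\<pi>. indecomposable \<pi> \<and> card (inversions \<pi>) = k \<and> (\<forall>\<tau>\<in>T. avoids \<pi> \<tau>)}"

end

theory Submission
  imports Defs
begin

text \<open>
  A permutation avoids both 132 and 123 exactly when every entry has at most one larger entry
  to its right: two such entries form, together with it, one of the two patterns
  (\<open>avoids_132_123_iff\<close>). The vector recording for each entry but the last whether
  there is one (\<open>1\<close>) or none (\<open>0\<close>) can be an arbitrary binary word, because reading from the
  left each entry is either the largest or the second largest of those not yet used. Its weight is
  the number of non-inversions, so among the permutations of length \<open>n\<close> exactly
  \<open>(n - 1) choose s\<close> are avoiders with \<open>s\<close> non-inversions (\<open>card_sparse_words\<close>).

  If such a permutation is a sum \<open>\<rho> \<oplus> \<tau>\<close>, all of \<open>\<tau>\<close> lies above and to the right of \<open>\<rho>\<close>, so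
  \<open>\<tau>\<close> has length one and every entry of \<open>\<rho>\<close> has a larger entry to its right. Hence the only
  decomposable avoider of length \<open>n \<ge> 2\<close> is the one with the maximal number \<open>n - 1\<close> of
  non-inversions (\<open>decomposable_iff\<close>).

  Put \<open>n = r + 1\<close>. The avoiders with \<open>s = r - j\<close> non-inversions have
  \<open>((r + 1) choose 2) - (r - j) = (r choose 2) + j\<close> inversions, and indecomposability means
  \<open>1 \<le> j\<close>. Every \<open>k \<ge> 1\<close> is \<open>(r choose 2) + j\<close> for exactly one pair with \<open>1 \<le> j \<le> r\<close>, so \<open>k\<close>
  determines the length, and the count is \<open>r choose (r - j) = r choose j\<close>.

  The exponent \<open>(n - 2) (n + 1) / 2\<close> equals \<open>(n choose 2) - 1\<close>; thus the \<open>n\<close>-th summand of the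
  series carries precisely the coefficients of the block of all \<open>k\<close> belonging to \<open>r = n\<close>. The
  blocks do not overlap, and so each coefficient of the partial sums is eventually constant.
\<close>

section \<open>Non-inversions and patterns\<close>

text \<open>
  The number of pairs of positions \<open>i < j\<close> whose entries increase. Larger entries to the right
  are counted as a set of values, so this reading is meant for words without repetitions only.
\<close>

fun noninv :: "'a::linorder list \<Rightarrow> nat" where
  "noninv [] = 0"
| "noninv (x # xs) = card {y \<in> set xs. x < y} + noninv xs"

text \<open>
  Every entry has at most one larger entry to its right (again for words without repetitions).
\<close>

fun at_most_one_above :: "'a::linorder list \<Rightarrow> bool" where
  "at_most_one_above [] \<longleftrightarrow> True"
| "at_most_one_above (x # xs) \<longleftrightarrow> card {y \<in> set xs. x < y} \<le> 1 \<and> at_most_one_above xs"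

lemma contains_pattern_three_iff:
  "contains_pattern \<pi> [a, b, c] \<longleftrightarrow>
     (\<exists>i j k. i < j \<and> j < k \<and> k < length \<pi> \<and> order_isomorphic [\<pi> ! i, \<pi> ! j, \<pi> ! k] [a, b, c])"
  (is "_ = ?R")
proof
  assume "contains_pattern \<pi> [a, b, c]"
  then obtain "is" where s: "sorted_wrt (<) is" "set is \<subseteq> {..<length \<pi>}"
    and o: "order_isomorphic (map (\<lambda>i. \<pi> ! i) is) [a, b, c]"
    unfolding contains_pattern_def by blast
  from o have "length is = 3" by (simp add: order_isomorphic_def)
  then obtain i j k where "is = [i, j, k]"
    by (auto simp: numeral_3_eq_3 length_Suc_conv)
  with s o show ?R by auto
next
  assume ?R
  then obtain i j k where "i < j" "j < k" "k < length \<pi>"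
    "order_isomorphic [\<pi> ! i, \<pi> ! j, \<pi> ! k] [a, b, c]" by blast
  then show "contains_pattern \<pi> [a, b, c]"
    unfolding contains_pattern_def by (intro exI[of _ "[i, j, k]"]) auto
qed

lemma contains_132_iff:
  "contains_pattern \<pi> [1,3,2] \<longleftrightarrow>
     (\<exists>i j k. i < j \<and> j < k \<and> k < length \<pi> \<and> \<pi> ! i < \<pi> ! k \<and> \<pi> ! k < \<pi> ! j)"
  unfolding contains_pattern_three_iff
  by (intro arg_cong[where f = Ex] ext) (auto simp: order_isomorphic_def All_less_Suc numeral_2_eq_2)

lemma contains_123_iff:
  "contains_pattern \<pi> [1,2,3] \<longleftrightarrow>
     (\<exists>i j k. i < j \<and> j < k \<and> k < length \<pi> \<and> \<pi> ! i < \<pi> ! j \<and> \<pi> ! j < \<pi> ! k)"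
  unfolding contains_pattern_three_iff
  by (intro arg_cong[where f = Ex] ext) (auto simp: order_isomorphic_def All_less_Suc numeral_2_eq_2)

lemma card_above_le_1_iff:
  assumes "distinct xs"
  shows "card {y \<in> set xs. x < y} \<le> 1 \<longleftrightarrow>
    \<not> (\<exists>j k. j < k \<and> k < length xs \<and> x < xs ! j \<and> x < xs ! k)"
proof -
  have "card {y \<in> set xs. x < y} \<le> 1 \<longleftrightarrow>
     (\<forall>j<length xs. \<forall>k<length xs. x < xs ! j \<longrightarrow> x < xs ! k \<longrightarrow> xs ! j = xs ! k)"
    by (auto simp: card_le_Suc0_iff_eq in_set_conv_nth)
  also have "\<dots> \<longleftrightarrow> (\<forall>j<length xs. \<forall>k<length xs. x < xs ! j \<longrightarrow> x < xs ! k \<longrightarrow> j = k)"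
    using assms by (auto simp: nth_eq_iff_index_eq)
  also have "\<dots> \<longleftrightarrow> \<not> (\<exists>j k. j < k \<and> k < length xs \<and> x < xs ! j \<and> x < xs ! k)"
  proof (intro iffI notI allI impI)
    assume "\<forall>j<length xs. \<forall>k<length xs. x < xs ! j \<longrightarrow> x < xs ! k \<longrightarrow> j = k"
      and "\<exists>j k. j < k \<and> k < length xs \<and> x < xs ! j \<and> x < xs ! k"
    then show False by (metis order.strict_trans nat_neq_iff)
  next
    fix j k
    assume "\<not> (\<exists>j k. j < k \<and> k < length xs \<and> x < xs ! j \<and> x < xs ! k)"
      and "j < length xs" "k < length xs" "x < xs ! j" "x < xs ! k"
    then show "j = k" by (cases j k rule: linorder_cases) blast+
  qed
  finally show ?thesis .
qed

lemma at_most_one_above_iff: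
  assumes "distinct xs"
  shows "at_most_one_above xs \<longleftrightarrow>
    \<not> (\<exists>i j k. i < j \<and> j < k \<and> k < length xs \<and> xs ! i < xs ! j \<and> xs ! i < xs ! k)"
  using assms
proof (induction xs)
  case (Cons x xs)
  have "(\<exists>i j k. i < j \<and> j < k \<and> k < length (x # xs) \<and>
            (x # xs) ! i < (x # xs) ! j \<and> (x # xs) ! i < (x # xs) ! k) \<longleftrightarrow>
      (\<exists>j k. j < k \<and> k < length xs \<and> x < xs ! j \<and> x < xs ! k) \<or>
      (\<exists>i j k. i < j \<and> j < k \<and> k < length xs \<and> xs ! i < xs ! j \<and> xs ! i < xs ! k)"
    (is "?L \<longleftrightarrow> ?R1 \<or> ?R2")
  proof
    assume ?L
    then obtain i j k where *: "i < j" "j < k" "k < length (x # xs)"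
      "(x # xs) ! i < (x # xs) ! j" "(x # xs) ! i < (x # xs) ! k" by blast
    then obtain j' k' where "j = Suc j'" "k = Suc k'" by (metis less_nat_zero_code not0_implies_Suc)
    with * show "?R1 \<or> ?R2" by (cases i) auto
  next
    assume "?R1 \<or> ?R2"
    then show ?L
    proof
      assume ?R1
      then obtain j k where "j < k" "k < length xs" "x < xs ! j" "x < xs ! k" by blast
      then show ?L by (intro exI[of _ 0] exI[of _ "Suc j"] exI[of _ "Suc k"]) auto
    next
      assume ?R2
      then obtain i j k where "i < j" "j < k" "k < length xs" "xs ! i < xs ! j" "xs ! i < xs ! k"
        by blast
      then show ?L by (intro exI[of _ "Suc i"] exI[of _ "Suc j"] exI[of _ "Suc k"]) auto
    qed
  qed
  with Cons card_above_le_1_iff[of xs x] show ?case by simp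
qed simp

lemma avoids_132_123_iff:
  assumes "distinct \<pi>"
  shows "avoids \<pi> [1,3,2] \<and> avoids \<pi> [1,2,3] \<longleftrightarrow> at_most_one_above \<pi>"
proof -
  have "contains_pattern \<pi> [1,3,2] \<or> contains_pattern \<pi> [1,2,3] \<longleftrightarrow>
    (\<exists>i j k. i < j \<and> j < k \<and> k < length \<pi> \<and> \<pi> ! i < \<pi> ! j \<and> \<pi> ! i < \<pi> ! k)"
    (is "_ \<longleftrightarrow> ?R")
  proof
    show ?R if "contains_pattern \<pi> [1,3,2] \<or> contains_pattern \<pi> [1,2,3]"
      using that unfolding contains_132_iff contains_123_iff by (meson less_trans)
    assume ?R
    then obtain i j k where *: "i < j" "j < k" "k < length \<pi>" "\<pi> ! i < \<pi> ! j" "\<pi> ! i < \<pi> ! k"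
      by blast
    then have "\<pi> ! j \<noteq> \<pi> ! k" using assms by (simp add: nth_eq_iff_index_eq)
    with * show "contains_pattern \<pi> [1,3,2] \<or> contains_pattern \<pi> [1,2,3]"
      unfolding contains_132_iff contains_123_iff by (meson linorder_neqE)
  qed
  then show ?thesis unfolding at_most_one_above_iff[OF assms] avoids_def by blast
qed

lemma inversions_Cons:
  "inversions (x # xs) =
     (\<lambda>j. (0, Suc j)) ` {j. j < length xs \<and> xs ! j < x} \<union> map_prod Suc Suc ` inversions xs"
proof (intro equalityI subsetI)
  fix p assume p: "p \<in> inversions (x # xs)"
  obtain i j where ij: "p = (i, j)" by force
  from p ij obtain j' where "j = Suc j'" unfolding inversions_def by (cases j) auto
  with p ij show "p \<in> (\<lambda>j. (0, Suc j)) ` {j. j < length xs \<and> xs ! j < x} \<union>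
      map_prod Suc Suc ` inversions xs"
    unfolding inversions_def by (cases i) (auto simp: image_iff)
qed (auto simp: inversions_def)

lemma finite_inversions: "finite (inversions xs)"
  by (rule finite_subset[of _ "{..<length xs} \<times> {..<length xs}"]) (auto simp: inversions_def)

lemma card_inversions_Cons:
  assumes "distinct xs"
  shows "card (inversions (x # xs)) = card {y \<in> set xs. y < x} + card (inversions xs)"
proof -
  have "card (inversions (x # xs)) =
      card ((\<lambda>j. (0::nat, Suc j)) ` {j. j < length xs \<and> xs ! j < x}) +
      card (map_prod Suc Suc ` inversions xs)"
    unfolding inversions_Cons by (rule card_Un_disjoint) (auto simp: finite_inversions)
  also have "card (map_prod Suc Suc ` inversions xs) = card (inversions xs)"
    by (rule card_image) (auto simp: inj_on_def)
  also have "card ((\<lambda>j. (0::nat, Suc j)) ` {j. j < length xs \<and> xs ! j < x}) =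
      card {j. j < length xs \<and> xs ! j < x}"
    by (rule card_image) (auto simp: inj_on_def)
  also have "\<dots> = card ((!) xs ` {j. j < length xs \<and> xs ! j < x})"
    using assms by (intro card_image[symmetric]) (auto simp: inj_on_def nth_eq_iff_index_eq)
  also have "(!) xs ` {j. j < length xs \<and> xs ! j < x} = {y \<in> set xs. y < x}"
    by (auto simp: in_set_conv_nth)
  finally show ?thesis .
qed

lemma card_inversions_plus_noninv:
  assumes "distinct xs"
  shows "card (inversions xs) + noninv xs = length xs choose 2"
  using assms
proof (induction xs)
  case Nil
  then show ?case by (simp add: inversions_def)
next
  case (Cons x xs)
  have "{y \<in> set xs. y < x} \<union> {y \<in> set xs. x < y} = set xs"
    using Cons.prems by (auto simp: not_less order.order_iff_strict)
  moreover have "card ({y \<in> set xs. y < x} \<union> {y \<in> set xs. x < y}) =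
      card {y \<in> set xs. y < x} + card {y \<in> set xs. x < y}"
    by (rule card_Un_disjoint) auto
  ultimately have "card {y \<in> set xs. y < x} + card {y \<in> set xs. x < y} = length xs"
    using Cons.prems by (simp add: distinct_card)
  with Cons show ?case
    by (simp add: card_inversions_Cons numeral_2_eq_2)
qed

lemma noninv_le:
  assumes "at_most_one_above xs"
  shows "noninv xs \<le> length xs - 1"
  using assms
proof (induction xs)
  case (Cons x xs)
  then show ?case by (cases xs) auto
qed simp

section \<open>Counting by non-inversions\<close>

text \<open>
  The arrangements of \<open>A\<close> that avoid 132 and 123 and have \<open>s\<close> non-inversions. Allowing an
  arbitrary set \<open>A\<close> of letters instead of \<open>{1..n}\<close> makes it possible to remove the first letter
  without renumbering the others.
\<close>

definition sparse_words :: "'a::linorder set \<Rightarrow> nat \<Rightarrow> 'a list set" where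
  "sparse_words A s = {xs. distinct xs \<and> set xs = A \<and> at_most_one_above xs \<and> noninv xs = s}"

lemma finite_sparse_words: "finite A \<Longrightarrow> finite (sparse_words A s)"
  by (rule finite_subset[OF _ finite_permutations_of_set[of A]])
     (auto simp: sparse_words_def permutations_of_set_def)

lemma Cons_in_sparse_words_iff:
  "x # xs \<in> sparse_words A s \<longleftrightarrow>
     x \<in> A \<and> card {y \<in> A. x < y} \<le> 1 \<and> card {y \<in> A. x < y} \<le> s \<and>
     xs \<in> sparse_words (A - {x}) (s - card {y \<in> A. x < y})"
proof -
  have set_iff: "x \<notin> set xs \<and> set (x # xs) = A \<longleftrightarrow> x \<in> A \<and> set xs = A - {x}" by auto
  show ?thesis
  proof (cases "x \<in> A \<and> set xs = A - {x}")
    case True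
    then have above: "{y \<in> set xs. x < y} = {y \<in> A. x < y}" by auto
    have shift: "c + n = s \<longleftrightarrow> c \<le> s \<and> n = s - c" for c n :: nat by auto
    have "x \<notin> set xs" "set (x # xs) = A" using True set_iff by blast+
    with True show ?thesis
      unfolding sparse_words_def mem_Collect_eq distinct.simps at_most_one_above.simps
        noninv.simps above shift
      by blast
  next
    case False
    then show ?thesis using set_iff unfolding sparse_words_def mem_Collect_eq distinct.simps by blast
  qed
qed

text \<open>
  By induction on \<open>A\<close>: the first letter is the largest or the second largest element of \<open>A\<close>, and it
  contributes no or one non-inversion, respectively, which is the recurrence of Pascal's triangle.
  For \<open>A = {}\<close> the formula holds as well, because \<open>0 - 1 = 0\<close> on natural numbers.
\<close>

lemma card_sparse_words:
  assumes "finite A"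
  shows "card (sparse_words A s) = (card A - 1) choose s"
  using assms
proof (induction "card A" arbitrary: A s rule: less_induct)
  case less
  consider "A = {}" | a where "A = {a}" | "card A \<ge> 2"
  proof -
    have "card A = 0 \<or> card A = 1 \<or> card A \<ge> 2" by linarith
    then show thesis using that less.prems card_1_singletonE[of A] by (auto simp del: One_nat_def)
  qed
  then show ?case
  proof cases
    case 1
    then have "sparse_words A s = (if s = 0 then {[]} else {})"
      by (auto simp: sparse_words_def)
    then show ?thesis using 1 by (cases s) auto
  next
    case 2
    have "distinct xs \<and> set xs = {a} \<longleftrightarrow> xs = [a]" for xs
    proof
      assume xs: "distinct xs \<and> set xs = {a}"
      then have "length xs = 1" using distinct_card[of xs] by simp
      then obtain y where "xs = [y]" by (cases xs) auto
      with xs show "xs = [a]" by simp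
    qed auto
    then have "sparse_words A s = {xs. xs = [a] \<and> at_most_one_above xs \<and> noninv xs = s}"
      unfolding sparse_words_def 2 by blast
    also have "\<dots> = (if s = 0 then {[a]} else {})" by auto
    finally have "sparse_words A s = (if s = 0 then {[a]} else {})" .
    then show ?thesis using 2 by (cases s) auto
  next
    case 3
    define M where "M = Max A"
    define M' where "M' = Max (A - {M})"
    have "A \<noteq> {}" using 3 by auto
    have "A - {M} \<noteq> {}"
    proof
      assume "A - {M} = {}"
      then have "card A \<le> card {M}" by (intro card_mono) auto
      with 3 show False by simp
    qed
    have M: "M \<in> A" "\<And>y. y \<in> A \<Longrightarrow> y \<le> M"
      using less.prems \<open>A \<noteq> {}\<close> by (auto simp: M_def)
    have "M' \<in> A - {M}" using less.prems \<open>A - {M} \<noteq> {}\<close> unfolding M'_def by (intro Max_in) auto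
    then have M': "M' \<in> A" "M' \<noteq> M" by auto
    have M'_max: "y \<le> M'" if "y \<in> A" "y \<noteq> M" for y
      using that less.prems unfolding M'_def by (intro Max_ge) auto
    have above_M: "{y \<in> A. M < y} = {}" using M by (auto simp: not_less)
    have above_M': "{y \<in> A. M' < y} = {M}"
      using M M' M'_max by (force simp: less_le)
    have above: "x = M \<or> x = M'" if "x \<in> A" "card {y \<in> A. x < y} \<le> 1" for x
    proof (rule ccontr)
      assume "\<not> (x = M \<or> x = M')"
      then have "{M, M'} \<subseteq> {y \<in> A. x < y}" using that M M' M'_max by (force simp: less_le)
      then have "card {M, M'} \<le> card {y \<in> A. x < y}" using less.prems by (intro card_mono) auto
      then show False using that M' by simp
    qed
    have nil: "[] \<notin> sparse_words A s" using \<open>A \<noteq> {}\<close> by (auto simp: sparse_words_def)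
    let ?B = "if s = 0 then {} else sparse_words (A - {M'}) (s - 1)"
    have eq: "sparse_words A s = (#) M ` sparse_words (A - {M}) s \<union> (#) M' ` ?B"
    proof (intro equalityI subsetI)
      fix ys assume ys: "ys \<in> sparse_words A s"
      with nil obtain x xs where x: "ys = x # xs" by (cases ys) auto
      with ys have c: "x \<in> A" "card {y \<in> A. x < y} \<le> 1" "card {y \<in> A. x < y} \<le> s"
        "xs \<in> sparse_words (A - {x}) (s - card {y \<in> A. x < y})"
        by (simp_all add: Cons_in_sparse_words_iff)
      from above[OF c(1,2)] show "ys \<in> (#) M ` sparse_words (A - {M}) s \<union> (#) M' ` ?B"
      proof
        assume "x = M"
        with c(4) x show ?thesis by (simp add: above_M)
      next
        assume "x = M'"
        with c(3,4) x show ?thesis by (simp add: above_M')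
      qed
    next
      fix ys assume "ys \<in> (#) M ` sparse_words (A - {M}) s \<union> (#) M' ` ?B"
      then show "ys \<in> sparse_words A s"
        using M(1) M'(1)
        by (auto simp: Cons_in_sparse_words_iff above_M above_M' split: if_splits)
    qed
    have "card (sparse_words A s) = card ((#) M ` sparse_words (A - {M}) s) + card ((#) M' ` ?B)"
      unfolding eq using less.prems M' by (intro card_Un_disjoint) (auto simp: finite_sparse_words)
    also have "\<dots> = card (sparse_words (A - {M}) s) + card ?B"
      by (simp add: card_image)
    also have "card (sparse_words (A - {M}) s) = (card A - 2) choose s"
      using less.hyps[of "A - {M}" s] less.prems M 3 by (simp add: numeral_2_eq_2)
    also have "card ?B = (if s = 0 then 0 else (card A - 2) choose (s - 1))"
      using less.hyps[of "A - {M'}" "s - 1"] less.prems M' 3 by (simp add: numeral_2_eq_2)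
    also have "(card A - 2 choose s) + (if s = 0 then 0 else card A - 2 choose (s - 1)) =
        (card A - 1) choose s"
    proof -
      obtain n where "card A = Suc (Suc n)" using 3 by (metis add_2_eq_Suc le_Suc_ex)
      then show ?thesis by (cases s) auto
    qed
    finally show ?thesis .
  qed
qed

section \<open>Decomposability\<close>

lemma noninv_append_top:
  assumes "\<And>x. x \<in> set xs \<Longrightarrow> x < m"
  shows "length xs \<le> noninv (xs @ [m])"
  using assms
proof (induction xs)
  case (Cons x xs)
  have "m \<in> {y \<in> set (xs @ [m]). x < y}" using Cons.prems by simp
  then have "card {y \<in> set (xs @ [m]). x < y} \<ge> 1"
    by (intro Suc_leI[of 0, folded One_nat_def]) (auto simp: card_gt_0_iff)
  moreover have "length xs \<le> noninv (xs @ [m])" using Cons by simp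
  ultimately show ?case by simp
qed simp

text \<open>
  If the number of non-inversions is maximal, every entry except the last has a larger one to its
  right, which forces the last entry to be the maximum.
\<close>

lemma last_is_top:
  assumes "at_most_one_above xs" "noninv xs = length xs - 1" "xs \<noteq> []"
  shows "\<forall>y\<in>set xs. y \<le> last xs"
  using assms
proof (induction xs)
  case (Cons x xs)
  show ?case
  proof (cases "xs = []")
    case False
    then have len: "length xs \<ge> 1" by (cases xs) auto
    have "noninv xs \<le> length xs - 1" using Cons.prems noninv_le[of xs] by simp
    with Cons.prems len have n: "noninv xs = length xs - 1" and c: "card {y \<in> set xs. x < y} = 1"
      by auto
    from n have IH: "\<forall>y\<in>set xs. y \<le> last xs" using Cons False by simp
    from c have "{y \<in> set xs. x < y} \<noteq> {}" by (metis card.empty zero_neq_one)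
    then obtain y where "y \<in> set xs" "x < y" by blast
    with IH have "x \<le> last xs" by (meson less_le_not_le order.trans)
    with IH False show ?thesis by simp
  qed simp
qed simp

lemma is_permutation_iff: "is_permutation \<pi> \<longleftrightarrow> distinct \<pi> \<and> set \<pi> = {1..length \<pi>}"
  by (auto simp: is_permutation_def permutations_of_set_def)

lemma at_most_one_above_append:
  assumes "at_most_one_above (x # xs @ ys)" "\<And>y. y \<in> set ys \<Longrightarrow> x < y"
  shows "card (set ys) \<le> 1"
proof -
  have "card (set ys) \<le> card {y \<in> set (xs @ ys). x < y}"
    using assms(2) by (intro card_mono) auto
  also have "\<dots> \<le> 1" using assms(1) by simp
  finally show ?thesis .
qed

lemma decomposable_iff:
  assumes "is_permutation \<pi>" "at_most_one_above \<pi>"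
  shows "decomposable \<pi> \<longleftrightarrow> length \<pi> \<ge> 2 \<and> noninv \<pi> = length \<pi> - 1"
proof
  assume "decomposable \<pi>"
  then obtain \<rho> \<tau> where p: "is_permutation \<rho>" "\<rho> \<noteq> []" "is_permutation \<tau>" "\<tau> \<noteq> []"
    and \<pi>: "\<pi> = perm_sum \<rho> \<tau>" unfolding decomposable_def by blast
  let ?\<tau> = "map (\<lambda>t. length \<rho> + t) \<tau>"
  have less: "x < y" if "x \<in> set \<rho>" "y \<in> set ?\<tau>" for x y
    using that p by (auto simp: is_permutation_iff)
  obtain x xs where \<rho>: "\<rho> = x # xs" using p by (cases \<rho>) auto
  have "card (set ?\<tau>) \<le> 1"
    using assms(2) less \<pi> \<rho> by (intro at_most_one_above_append[of x xs]) (auto simp: perm_sum_def)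
  moreover have "distinct ?\<tau>" using p by (simp add: distinct_map is_permutation_iff)
  ultimately have "length ?\<tau> \<le> 1" using distinct_card[of ?\<tau>] by linarith
  then have "length \<tau> \<le> 1" by simp
  then obtain t where t: "\<tau> = [t]" using p(4) by (cases \<tau>) auto
  have "length \<rho> \<le> noninv \<pi>"
    unfolding \<pi> perm_sum_def t using less t by (simp add: noninv_append_top)
  moreover have "noninv \<pi> \<le> length \<pi> - 1" using assms by (intro noninv_le)
  moreover have "length \<pi> = length \<rho> + 1" using \<pi> t by (simp add: perm_sum_def)
  ultimately show "length \<pi> \<ge> 2 \<and> noninv \<pi> = length \<pi> - 1" using \<rho> by simp
next
  assume *: "length \<pi> \<ge> 2 \<and> noninv \<pi> = length \<pi> - 1"
  then have ne: "\<pi> \<noteq> []" by auto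
  define n where "n = length \<pi> - 1"
  have len: "length \<pi> = Suc n" using ne by (cases \<pi>) (simp_all add: n_def)
  have set: "set \<pi> = {1..Suc n}" and dist: "distinct \<pi>"
    using assms(1) by (simp_all add: is_permutation_iff len)
  have "Suc n \<in> set \<pi>" using set by simp
  then have "Suc n \<le> last \<pi>" using last_is_top[OF assms(2)] * ne by simp
  moreover have "last \<pi> \<in> set \<pi>" using ne by simp
  ultimately have last: "last \<pi> = Suc n" using set by simp
  have split: "\<pi> = butlast \<pi> @ [Suc n]" using ne last by (metis append_butlast_last_id)
  have "distinct (butlast \<pi> @ [Suc n])" using dist split by simp
  then have db: "distinct (butlast \<pi>)" "Suc n \<notin> set (butlast \<pi>)" by simp_all
  have "set (butlast \<pi> @ [Suc n]) = {1..Suc n}" using set split by simp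
  then have "insert (Suc n) (set (butlast \<pi>)) = insert (Suc n) {1..n}"
    by (simp add: atLeastAtMostSuc_conv)
  then have "set (butlast \<pi>) = {1..n}" using db(2) by (subst (asm) insert_ident) auto
  with db(1) have "is_permutation (butlast \<pi>)" by (simp add: is_permutation_iff len)
  moreover have "is_permutation [1]" by (auto simp: is_permutation_iff)
  moreover have "\<pi> = perm_sum (butlast \<pi>) [1]" using split by (simp add: perm_sum_def len)
  moreover have "butlast \<pi> \<noteq> []" using * len by (simp flip: length_greater_0_conv)
  ultimately show "decomposable \<pi>" unfolding decomposable_def by blast
qed

section \<open>The triangular blocks\<close>

lemma choose_two_mono: "m \<le> n \<Longrightarrow> m choose 2 \<le> n choose 2"
  by (induction rule: dec_induct) (auto simp: numeral_2_eq_2)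

lemma Suc_choose_two: "Suc n choose 2 = (n choose 2) + n"
  by (simp add: numeral_2_eq_2)

text \<open>
  The intervals \<open>{(r choose 2) + 1 .. (r choose 2) + r}\<close> for \<open>r \<ge> 1\<close> partition the positive integers.
\<close>

lemma triangular_unique:
  assumes "(r choose 2) + j = (r' choose 2) + j'" "1 \<le> j" "j \<le> r" "1 \<le> j'" "j' \<le> r'"
  shows "r = r'" "j = j'"
proof -
  \<comment> \<open>If \<open>a < b\<close>, then the block of \<open>a\<close> ends at \<open>(a choose 2) + a = (Suc a choose 2)\<close>, before that
    of \<open>b\<close> begins.\<close>
  have False if "a < b" "(a choose 2) + i = (b choose 2) + i'" "i \<le> a" "1 \<le> i'" for a b i i'
    using that choose_two_mono[of "Suc a" b] Suc_choose_two[of a] by simp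
  from this[of r r' j j'] this[of r' r j' j] assms show "r = r'" by (metis nat_neq_iff)
  with assms show "j = j'" by simp
qed

lemma triangular_exists:
  assumes "1 \<le> k"
  obtains r j where "1 \<le> j" "j \<le> r" "k = (r choose 2) + j"
proof -
  have "\<exists>r j. 1 \<le> j \<and> j \<le> r \<and> k = (r choose 2) + j"
    using assms
  proof (induction k rule: dec_induct)
    case base
    then show ?case by (intro exI[of _ 1]) (auto simp: numeral_2_eq_2)
  next
    case (step k)
    then obtain r j where rj: "1 \<le> j" "j \<le> r" "k = (r choose 2) + j" by blast
    show ?case
    proof (cases "j = r")
      case True
      with rj show ?thesis by (intro exI[of _ "Suc r"] exI[of _ 1]) (simp add: Suc_choose_two)
    next
      case False
      with rj show ?thesis by (intro exI[of _ r] exI[of _ "Suc j"]) simp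
    qed
  qed
  with that show thesis by blast
qed

text \<open>
  The number of inversions determines the length \<open>Suc r\<close>, and indecomposability then amounts
  to having fewer than \<open>r\<close> non-inversions.
\<close>

lemma indec_avoiders_eq:
  assumes "1 \<le> j" "j \<le> r"
  shows "indec_avoiders ((r choose 2) + j) {[1,3,2], [1,2,3]} = sparse_words {1..Suc r} (r - j)"
proof (intro equalityI subsetI)
  fix \<pi> assume "\<pi> \<in> indec_avoiders ((r choose 2) + j) {[1,3,2], [1,2,3]}"
  then have p: "is_permutation \<pi>" and ne: "\<pi> \<noteq> []" and nd: "\<not> decomposable \<pi>"
    and inv: "card (inversions \<pi>) = (r choose 2) + j"
    and av: "avoids \<pi> [1,3,2]" "avoids \<pi> [1,2,3]"
    by (auto simp: indec_avoiders_def indecomposable_def)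
  have d: "distinct \<pi>" using p by (simp add: is_permutation_iff)
  have a: "at_most_one_above \<pi>" using av avoids_132_123_iff[OF d] by blast
  define n where "n = length \<pi> - 1"
  have len: "length \<pi> = Suc n" using ne by (cases \<pi>) (simp_all add: n_def)
  have sum: "card (inversions \<pi>) + noninv \<pi> = (n choose 2) + n"
    using card_inversions_plus_noninv[OF d] by (simp add: len Suc_choose_two)
  have "n \<noteq> 0" using sum inv assms by (intro notI) (simp add: numeral_2_eq_2)
  then have "noninv \<pi> \<noteq> n" using decomposable_iff[OF p a] nd len by auto
  with noninv_le[OF a] len have lt: "noninv \<pi> < n" by simp
  have "(r choose 2) + j = (n choose 2) + (n - noninv \<pi>)" using sum inv lt by simp
  from triangular_unique[OF this assms] lt have "r = n" "j = n - noninv \<pi>" by auto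
  with lt show "\<pi> \<in> sparse_words {1..Suc r} (r - j)"
    using p a len by (auto simp: sparse_words_def is_permutation_iff)
next
  fix \<pi> assume "\<pi> \<in> sparse_words {1..Suc r} (r - j)"
  then have d: "distinct \<pi>" and set: "set \<pi> = {1..Suc r}" and a: "at_most_one_above \<pi>"
    and n: "noninv \<pi> = r - j" by (auto simp: sparse_words_def)
  have len: "length \<pi> = Suc r" using distinct_card[OF d] set by simp
  have p: "is_permutation \<pi>" using d set len by (simp add: is_permutation_iff)
  have "\<not> decomposable \<pi>" using decomposable_iff[OF p a] len n assms by simp
  moreover have "card (inversions \<pi>) = (r choose 2) + j"
    using card_inversions_plus_noninv[OF d] assms by (simp add: len Suc_choose_two n)
  moreover have "\<pi> \<noteq> []" using len by auto
  ultimately show "\<pi> \<in> indec_avoiders ((r choose 2) + j) {[1,3,2], [1,2,3]}"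
    using p a avoids_132_123_iff[OF d] by (auto simp: indec_avoiders_def indecomposable_def)
qed

lemma card_indec_avoiders:
  assumes "1 \<le> j" "j \<le> r"
  shows "card (indec_avoiders ((r choose 2) + j) {[1,3,2], [1,2,3]}) = r choose j"
  unfolding indec_avoiders_eq[OF assms]
  using assms by (simp add: card_sparse_words binomial_symmetric[of j r] del: One_nat_def)

section \<open>The generating function\<close>

text \<open>
  Convergence in the metric of formal Laurent series. Agreement is required of all
  coefficients below a bound at the same time: convergence of each coefficient separately would not
  suffice, as the orders of the series could tend to \<open>-\<infinity>\<close>.
\<close>

lemma tendsto_flsI:
  fixes f :: "'b \<Rightarrow> 'a::group_add fls"
  assumes "\<And>N. \<forall>\<^sub>F x in F. \<forall>m<N. fls_nth (f x) m = fls_nth l m"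
  shows "(f \<longlongrightarrow> l) F"
proof (rule tendstoI)
  fix e :: real assume "e > 0"
  then obtain N where N: "(1/2) ^ N < e" using real_arch_pow_inv[of e "1/2"] by auto
  show "\<forall>\<^sub>F x in F. dist (f x) l < e"
    using assms[of "int N"]
  proof eventually_elim
    case (elim x)
    show ?case
    proof (cases "f x = l")
      case False
      then have "int N \<le> fls_subdegree (f x - l)"
        using elim by (intro fls_subdegree_geI) auto
      then have "N \<le> nat (fls_subdegree (f x - l))"
        and dist: "dist (f x) l = (1/2) ^ nat (fls_subdegree (f x - l))"
        using False by (auto simp: dist_fls_def power_one_over inverse_eq_divide)
      then have "dist (f x) l \<le> (1/2) ^ N"
        unfolding dist by (intro power_decreasing) auto
      with N show ?thesis by simp
    qed (use \<open>e > 0\<close> in simp)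
  qed
qed

lemma fls_nth_X_plus_1_power:
  "fls_nth ((fls_X + 1) ^ n :: int fls) m = (if m < 0 then 0 else int (n choose nat m))"
proof -
  have "(fls_X + 1) ^ n = (fps_to_fls ((fps_X + 1) ^ n) :: int fls)"
    by (simp add: fps_to_fls_power)
  also have "(fps_X + 1) ^ n = (\<Sum>k\<le>n. of_nat (n choose k) * fps_X ^ k :: int fps)"
    by (simp add: binomial_ring)
  finally have "fls_nth ((fls_X + 1) ^ n :: int fls) m =
     (if m < 0 then 0 else fps_nth (\<Sum>k\<le>n. of_nat (n choose k) * fps_X ^ k :: int fps) (nat m))"
    by simp
  also have "fps_nth (\<Sum>k\<le>n. of_nat (n choose k) * fps_X ^ k :: int fps) i = int (n choose i)" for i
  proof -
    have "fps_nth (\<Sum>k\<le>n. of_nat (n choose k) * fps_X ^ k :: int fps) i =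
      (\<Sum>k\<le>n. if k = i then int (n choose k) else 0)"
      unfolding fps_sum_nth by (intro sum.cong refl) (simp flip: fps_of_nat)
    also have "\<dots> = int (n choose i)" by (auto simp: binomial_eq_0)
    finally show ?thesis .
  qed
  finally show ?thesis .
qed

lemma intpow_exponent: "(int n - 2) * (int n + 1) div 2 = int (n choose 2) - 1"
proof -
  have "2 * int (n choose 2) = int n * (int n - 1)"
    by (induction n) (simp_all add: Suc_choose_two algebra_simps numeral_2_eq_2)
  then have "(int n - 2) * (int n + 1) = 2 * (int (n choose 2) - 1)"
    by (simp add: algebra_simps)
  then show ?thesis by simp
qed

text \<open>
  The \<open>n\<close>-th summand of the generating function. For \<open>n = 1\<close> the exponent is \<open>-1\<close>.
\<close>

definition block :: "nat \<Rightarrow> int fls" where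
  "block n = fls_X_intpow ((int n - 2) * (int n + 1) div 2) * ((fls_X + 1) ^ n - 1)"

lemma fls_nth_block:
  "fls_nth (block n) m =
     (if m < int (n choose 2) then 0 else int (n choose nat (m + 1 - int (n choose 2))))"
proof -
  have "fls_nth (block n) m = fls_nth ((fls_X + 1) ^ n - 1) (m + 1 - int (n choose 2))"
    unfolding block_def intpow_exponent fls_X_intpow_times_conv_shift
    by (simp add: algebra_simps)
  then show ?thesis by (auto simp: fls_nth_X_plus_1_power)
qed

lemma fls_nth_block_neg: "m < 0 \<Longrightarrow> fls_nth (block n) m = 0"
  by (simp add: fls_nth_block)

text \<open>
  Each coefficient with nonnegative index comes from exactly one summand.
\<close>

lemma fls_nth_block_triangular:
  assumes "1 \<le> j" "j \<le> r" "Suc m = (r choose 2) + j"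
  shows "fls_nth (block n) (int m) = (if n = r then int (r choose j) else 0)"
proof (cases "m < n choose 2")
  case True
  with assms show ?thesis by (auto simp: fls_nth_block)
next
  case False
  define i where "i = Suc m - (n choose 2)"
  have i: "Suc m = (n choose 2) + i" "1 \<le> i" using False by (auto simp: i_def)
  have "nat (int m + 1 - int (n choose 2)) = i" using i by simp
  then have nth: "fls_nth (block n) (int m) = int (n choose i)" using False by (simp add: fls_nth_block)
  show ?thesis
  proof (cases "i \<le> n")
    case True
    then have "n = r" "i = j" using triangular_unique[of n i r j] i assms by simp_all
    then show ?thesis using nth by simp
  next
    case False
    then have "n \<noteq> r" using i assms by auto
    with nth False show ?thesis by (simp add: binomial_eq_0)
  qed
qed

lemma has_sum_block:
  "(block has_sum
      fps_to_fls (Abs_fps (\<lambda>m. int (card (indec_avoiders (m + 1) {[1,3,2], [1,2,3]}))))) {1..}"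
  (is "(_ has_sum ?S) _")
  unfolding has_sum_def
proof (rule tendsto_flsI)
  fix N :: int
  have *: "fls_nth (sum block Y) m = fls_nth ?S m"
    if Y: "finite Y" "{1..nat N} \<subseteq> Y" "Y \<subseteq> {1..}" and "m < N" for Y m
  proof (cases "m < 0")
    case True
    then show ?thesis by (simp add: fls_nth_sum fls_nth_block_neg)
  next
    case False
    then obtain k where k: "m = int k" using nonneg_int_cases not_less by metis
    obtain r j where rj: "1 \<le> j" "j \<le> r" "Suc k = (r choose 2) + j"
      by (rule triangular_exists[of "Suc k"]) simp_all
    \<comment> \<open>The one summand that contributes to the coefficient \<open>m\<close> has index \<open>r \<le> m + 1 \<le> N\<close>.\<close>
    have "r \<le> Suc (r choose 2)"
      by (cases r) (auto simp: Suc_choose_two)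
    then have "r \<le> nat N" using rj k \<open>m < N\<close> by linarith
    then have "r \<in> Y" using Y rj by auto
    then have "fls_nth (sum block Y) m = int (r choose j)"
      using Y(1) by (simp add: fls_nth_sum k fls_nth_block_triangular[OF rj])
    then show ?thesis using card_indec_avoiders[OF rj(1,2)] by (simp add: k rj(3))
  qed
  show "\<forall>\<^sub>F Y in finite_subsets_at_top {1..}. \<forall>m<N. fls_nth (sum block Y) m = fls_nth ?S m"
    unfolding eventually_finite_subsets_at_top
  proof (intro exI[of _ "{1..nat N}"] conjI allI impI)
    fix Y m
    assume Y: "finite Y \<and> {1..nat N} \<subseteq> Y \<and> Y \<subseteq> {1..}" and "m < N"
    show "fls_nth (sum block Y) m = fls_nth ?S m"
      by (rule * [OF conjunct1[OF Y] _ _ \<open>m < N\<close>]) (use Y in simp_all)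
  qed simp_all
qed

theorem theorem13:
  shows "(\<forall>r j k :: nat. 1 \<le> r \<and> 1 \<le> j \<and> j \<le> r \<and> k = (r choose 2) + j \<longrightarrow>
            card (indec_avoiders k {[1,3,2], [1,2,3]}) = r choose j) \<and>
         ((\<lambda>n :: nat. fls_X_intpow ((int n - 2) * (int n + 1) div 2) * ((fls_X + 1) ^ n - 1))
            has_sum
          fps_to_fls (Abs_fps (\<lambda>m. int (card (indec_avoiders (m + 1) {[1,3,2], [1,2,3]})))))
           {1..}"
proof (intro conjI allI impI)
  fix r j k :: nat
  assume "1 \<le> r \<and> 1 \<le> j \<and> j \<le> r \<and> k = (r choose 2) + j"
  then show "card (indec_avoiders k {[1,3,2], [1,2,3]}) = r choose j"
    using card_indec_avoiders[of j r] by blast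
next
  show "((\<lambda>n :: nat. fls_X_intpow ((int n - 2) * (int n + 1) div 2) * ((fls_X + 1) ^ n - 1))
            has_sum
          fps_to_fls (Abs_fps (\<lambda>m. int (card (indec_avoiders (m + 1) {[1,3,2], [1,2,3]})))))
           {1..}"
    using has_sum_block unfolding block_def[abs_def] .
qed

end
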